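(* Let $k\ge 1$ and let $X$ be a finite $k$-dimensional simplicial complex with vertex set $V$. Let $A_0,A_1,\dots,A_k$ be a partition of $V$ into nonempty sets that attains the minimum in the definition of $h(X)$. Define \[ C(X) := \max\Bigl\{\sum_{v \in \tau^{\partial}} d(\tau^{\partial}\setminus\{v\}) : \tau^{\partial} \in F^{\partial}(A_0,A_1,\dots,A_k)\Bigr\}, \] where for a $(k-1)$-face $\sigma\in X_{k-1}$ we set $d(\sigma) := |\{\tau^{\partial} \in F^{\partial}(A_0,A_1,\dots,A_k): \sigma \subseteq \tau^{\partial}\}|$. Then \[ \lambda(X) \leq \frac{C(X)}{|V|}\, h(X). \] In particular, if there is $C$ such that every $(k-1)$-face $\sigma\in X_{k-1}$ is contained in at most $C$ $k$-faces of $K(X)$, i.e. $|\{\tau \in K(X)_k :\sigma \subseteq \tau \}| \leq C$ for all $\sigma\in X_{k-1}$, then $C(X) \leq (k+1) C$ and hence \[ \lambda(X) \leq \frac{(k+1)C}{|V|}\, h(X). \]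
   Context: A (finite abstract) simplicial complex $X$ on a finite vertex set $V$ is a family of subsets of $V$ closed under taking subsets; $X_i$ denotes its set of $i$-faces (faces with $i+1$ elements), and $X$ is $k$-dimensional if its largest face has $k+1$ elements. Fix a linear order on $V$; an $i$-face $\tau=\{v_0<\dots<v_i\}$ gets oriented incidence numbers $[\tau:\sigma]=(-1)^j$ if $\sigma=\tau\setminus\{v_j\}$ and $[\tau:\sigma]=0$ if $\sigma\not\subseteq\tau$. Real cochains: $C^i=C^i(X;\mathbb{R})$ is the space of functions $X_i\to\mathbb{R}$ with inner product $\langle f,g\rangle=\sum_{\tau\in X_i}f(\tau)g(\tau)$; the coboundary $\delta_i:C^i\to C^{i+1}$ is $\delta_i f(\tau)=\sum_{\sigma\in X_i}[\tau:\sigma]f(\sigma)$ (with $X_{-1}=\{\emptyset\}$). Let $\partial_{i+1}$ be the adjoint of $\delta_i$, $B^{k-1}=\operatorname{im}\delta_{k-2}$, $Z_{k-1}=\ker\partial_{k-1}=(B^{k-1})^\perp$, and the upper Laplacian $L^{\mathrm{up}}_{k-1}(X)=\partial_k\delta_{k-1}$ on $C^{k-1}$. The spectral gap $\lambda(X)$ is the smallest eigenvalue of $L^{\mathrm{up}}_{k-1}(X)$ restricted to $(B^{k-1})^\perp=Z_{k-1}$ (independent of the chosen order). The $k$-dimensional completion of $X$ is $K(X):=X\cup\{\tau\subseteq V: |\tau|=k+1,\ \tau\setminus\{v\}\in X \text{ for all } v\in\tau\}$. For a partition $V=A_0\sqcup\dots\sqcup A_k$, $F(A_0,\dots,A_k)$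 is the set of $k$-faces of $X$ with exactly one vertex in each $A_i$, and $F^{\partial}(A_0,\dots,A_k)$ is the set of $(k+1)$-element sets $\tau^\partial\in K(X)$ with $|\tau^\partial\cap A_i|=1$ for all $i$. The Cheeger constant is \[h(X):=\min_{V=\sqcup_{i=0}^k A_i,\ A_i\neq\emptyset}\frac{|V|\,|F(A_0,\dots,A_k)|}{|F^{\partial}(A_0,\dots,A_k)|},\] where a quotient with zero denominator is defined to be $\infty$. *)

theory Defs
  imports Complex_Main "HOL-Library.Extended_Real" "HOL-Library.Disjoint_Sets" "HOL-Library.FuncSet"
begin

definition abstract_complex :: "'a set \<Rightarrow> 'a set set \<Rightarrow> bool" where
  "abstract_complex V X \<longleftrightarrow>
     finite V \<and> (\<forall>\<tau>\<in>X. \<tau> \<subseteq> V) \<and> (\<forall>\<tau>\<in>X. \<forall>\<sigma>. \<sigma> \<subseteq> \<tau> \<longrightarrow> \<sigma> \<in> X)"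

definition k_dimensional :: "'a set set \<Rightarrow> nat \<Rightarrow> bool" where
  "k_dimensional X k \<longleftrightarrow> (\<exists>\<tau>\<in>X. card \<tau> = k + 1) \<and> (\<forall>\<tau>\<in>X. card \<tau> \<le> k + 1)"

text \<open>Dimensions are integers, so that the \<open>-1\<close>-face \<open>{}\<close> fits the general pattern.\<close>

definition ifaces :: "'a set set \<Rightarrow> int \<Rightarrow> 'a set set" where
  "ifaces X i = {\<tau> \<in> X. int (card \<tau>) = i + 1}"

text \<open>In \<open>\<tau> = {v\<^sub>0 < \<dots> < v\<^sub>i}\<close> the position \<open>j\<close> of the vertex \<open>v\<^sub>j\<close> is the number of
  vertices of \<open>\<tau>\<close> below it.\<close>

definition incidence :: "'a::linorder set \<Rightarrow> 'a set \<Rightarrow> real" where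
  "incidence \<tau> \<sigma> =
     (if \<exists>v\<in>\<tau>. \<sigma> = \<tau> - {v} then (- 1) ^ card {u \<in> \<tau>. u < the_elem (\<tau> - \<sigma>)} else 0)"

text \<open>A function on the \<open>i\<close>-faces is represented by its extension by zero to all sets.\<close>

definition cochains :: "'a set set \<Rightarrow> int \<Rightarrow> ('a set \<Rightarrow> real) set" where
  "cochains X i = {f. \<forall>\<sigma>. \<sigma> \<notin> ifaces X i \<longrightarrow> f \<sigma> = 0}"

definition cochain_inner ::
    "'a set set \<Rightarrow> int \<Rightarrow> ('a set \<Rightarrow> real) \<Rightarrow> ('a set \<Rightarrow> real) \<Rightarrow> real" where
  "cochain_inner X i f g = (\<Sum>\<tau>\<in>ifaces X i. f \<tau> * g \<tau>)"

definition coboundary ::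
    "'a::linorder set set \<Rightarrow> int \<Rightarrow> ('a set \<Rightarrow> real) \<Rightarrow> ('a set \<Rightarrow> real)" where
  "coboundary X i f =
     (\<lambda>\<tau>. if \<tau> \<in> ifaces X (i + 1) then \<Sum>\<sigma>\<in>ifaces X i. incidence \<tau> \<sigma> * f \<sigma> else 0)"

text \<open>The adjoint, from \<open>i\<close>-cochains to \<open>(i - 1)\<close>-cochains, of \<open>coboundary X (i - 1)\<close>; see
  \<open>boundary_adjoint\<close> and \<open>boundary_eq\<close> below.\<close>

definition boundary ::
    "'a::linorder set set \<Rightarrow> int \<Rightarrow> ('a set \<Rightarrow> real) \<Rightarrow> ('a set \<Rightarrow> real)" where
  "boundary X i g =
     (THE f. f \<in> cochains X (i - 1) \<and>
        (\<forall>h\<in>cochains X (i - 1).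
           cochain_inner X i (coboundary X (i - 1) h) g = cochain_inner X (i - 1) h f))"

definition coboundaries :: "'a::linorder set set \<Rightarrow> int \<Rightarrow> ('a set \<Rightarrow> real) set" where
  "coboundaries X i = coboundary X (i - 1) ` cochains X (i - 1)"

definition cycles :: "'a::linorder set set \<Rightarrow> int \<Rightarrow> ('a set \<Rightarrow> real) set" where
  "cycles X i = {f \<in> cochains X i. boundary X i f = (\<lambda>_. 0)}"

definition coboundaries_perp :: "'a::linorder set set \<Rightarrow> int \<Rightarrow> ('a set \<Rightarrow> real) set" where
  "coboundaries_perp X i =
     {f \<in> cochains X i. \<forall>b\<in>coboundaries X i. cochain_inner X i f b = 0}"

definition up_laplacian ::
    "'a::linorder set set \<Rightarrow> int \<Rightarrow> ('a set \<Rightarrow> real) \<Rightarrow> ('a set \<Rightarrow> real)" where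
  "up_laplacian X i f = boundary X (i + 1) (coboundary X i f)"

definition is_eigenvalue_on ::
    "('b \<Rightarrow> real) set \<Rightarrow> (('b \<Rightarrow> real) \<Rightarrow> ('b \<Rightarrow> real)) \<Rightarrow> real \<Rightarrow> bool" where
  "is_eigenvalue_on W L \<mu> \<longleftrightarrow> (\<exists>f\<in>W. f \<noteq> (\<lambda>_. 0) \<and> L f = (\<lambda>x. \<mu> * f x))"

definition spectral_gap :: "'a::linorder set set \<Rightarrow> nat \<Rightarrow> real" where
  "spectral_gap X k =
     (LEAST \<mu>. is_eigenvalue_on (coboundaries_perp X (int k - 1)) (up_laplacian X (int k - 1)) \<mu>)"

definition k_completion :: "'a set \<Rightarrow> 'a set set \<Rightarrow> nat \<Rightarrow> 'a set set" where
  "k_completion V X k = X \<union> {\<tau>. \<tau> \<subseteq> V \<and> card \<tau> = k + 1 \<and> (\<forall>v\<in>\<tau>. \<tau> - {v} \<in> X)}"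

definition nonempty_partition :: "'a set \<Rightarrow> nat \<Rightarrow> (nat \<Rightarrow> 'a set) \<Rightarrow> bool" where
  "nonempty_partition V k A \<longleftrightarrow>
     (\<Union>i\<le>k. A i) = V \<and> disjoint_family_on A {..k} \<and> (\<forall>i\<le>k. A i \<noteq> {})"

definition rainbow_faces :: "'a set set \<Rightarrow> nat \<Rightarrow> (nat \<Rightarrow> 'a set) \<Rightarrow> 'a set set" where
  "rainbow_faces X k A = {\<tau> \<in> ifaces X (int k). \<forall>i\<le>k. card (\<tau> \<inter> A i) = 1}"

definition rainbow_completion_faces ::
    "'a set \<Rightarrow> 'a set set \<Rightarrow> nat \<Rightarrow> (nat \<Rightarrow> 'a set) \<Rightarrow> 'a set set" where
  "rainbow_completion_faces V X k A =
     {\<tau> \<in> k_completion V X k. card \<tau> = k + 1 \<and> (\<forall>i\<le>k. card (\<tau> \<inter> A i) = 1)}"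

definition cheeger_quotient ::
    "'a set \<Rightarrow> 'a set set \<Rightarrow> nat \<Rightarrow> (nat \<Rightarrow> 'a set) \<Rightarrow> ereal" where
  "cheeger_quotient V X k A =
     (if card (rainbow_completion_faces V X k A) = 0 then \<infinity>
      else ereal (real (card V) * real (card (rainbow_faces X k A))
                  / real (card (rainbow_completion_faces V X k A))))"

definition cheeger_constant :: "'a set \<Rightarrow> 'a set set \<Rightarrow> nat \<Rightarrow> ereal" where
  "cheeger_constant V X k = Min (cheeger_quotient V X k ` {A. nonempty_partition V k A})"

definition rainbow_degree ::
    "'a set \<Rightarrow> 'a set set \<Rightarrow> nat \<Rightarrow> (nat \<Rightarrow> 'a set) \<Rightarrow> 'a set \<Rightarrow> nat" where
  "rainbow_degree V X k A \<sigma> = card {\<tau> \<in> rainbow_completion_faces V X k A. \<sigma> \<subseteq> \<tau>}"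

definition max_degree_sum ::
    "'a set \<Rightarrow> 'a set set \<Rightarrow> nat \<Rightarrow> (nat \<Rightarrow> 'a set) \<Rightarrow> nat" where
  "max_degree_sum V X k A =
     Max ((\<lambda>\<tau>. \<Sum>v\<in>\<tau>. rainbow_degree V X k A (\<tau> - {v})) ` rainbow_completion_faces V X k A)"

lemma abstract_complex_finite: "finite X" if "abstract_complex V X"
  using that unfolding abstract_complex_def by (meson Pow_iff finite_Pow_iff finite_subset subsetI)

lemma finite_ifaces: "finite (ifaces X i)" if "finite X"
  using that by (simp add: ifaces_def)

lemma coboundary_mem: "coboundary X i f \<in> cochains X (i + 1)"
  by (simp add: coboundary_def cochains_def)

lemma boundary_eq:
  fixes X :: "'a::linorder set set"
  assumes "finite X"
  shows "boundary X i g =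
    (\<lambda>\<sigma>. if \<sigma> \<in> ifaces X (i - 1) then \<Sum>\<tau>\<in>ifaces X i. incidence \<tau> \<sigma> * g \<tau> else 0)"
    (is "_ = ?f")
  unfolding boundary_def
proof (rule the_equality)
  have *: "cochain_inner X i (coboundary X (i - 1) h) g = cochain_inner X (i - 1) h ?f" for h
  proof -
    have "cochain_inner X i (coboundary X (i - 1) h) g =
        (\<Sum>\<tau>\<in>ifaces X i. \<Sum>\<sigma>\<in>ifaces X (i - 1). incidence \<tau> \<sigma> * h \<sigma> * g \<tau>)"
      by (simp add: cochain_inner_def coboundary_def sum_distrib_right)
    also have "\<dots> = (\<Sum>\<sigma>\<in>ifaces X (i - 1). \<Sum>\<tau>\<in>ifaces X i. incidence \<tau> \<sigma> * h \<sigma> * g \<tau>)"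
      by (rule sum.swap)
    also have "\<dots> = cochain_inner X (i - 1) h ?f"
      by (simp add: cochain_inner_def sum_distrib_left mult_ac)
    finally show ?thesis .
  qed
  then show "?f \<in> cochains X (i - 1) \<and>
     (\<forall>h\<in>cochains X (i - 1).
        cochain_inner X i (coboundary X (i - 1) h) g = cochain_inner X (i - 1) h ?f)"
    by (simp add: cochains_def)
  fix f
  assume f: "f \<in> cochains X (i - 1) \<and>
     (\<forall>h\<in>cochains X (i - 1).
        cochain_inner X i (coboundary X (i - 1) h) g = cochain_inner X (i - 1) h f)"
  show "f = ?f"
  proof
    fix \<sigma>
    show "f \<sigma> = ?f \<sigma>"
    proof (cases "\<sigma> \<in> ifaces X (i - 1)")
      case True
      define h :: "'a set \<Rightarrow> real" where "h = (\<lambda>\<rho>. if \<rho> = \<sigma> then 1 else 0)"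
      have ev: "cochain_inner X (i - 1) h u = u \<sigma>" for u
      proof -
        have "cochain_inner X (i - 1) h u =
            (\<Sum>\<tau>\<in>ifaces X (i - 1). if \<tau> = \<sigma> then u \<tau> else 0)"
          unfolding cochain_inner_def by (rule sum.cong) (auto simp: h_def)
        then show ?thesis
          using True finite_ifaces[OF assms, of "i - 1"] by simp
      qed
      have "h \<in> cochains X (i - 1)"
        using True by (auto simp: h_def cochains_def)
      then have "cochain_inner X (i - 1) h f = cochain_inner X (i - 1) h ?f"
        using f * by metis
      then show ?thesis
        unfolding ev .
    next
      case False
      then show ?thesis
        using f by (simp add: cochains_def)
    qed
  qed
qed

lemma boundary_adjoint:
  assumes "finite X"
  shows "cochain_inner X i (coboundary X (i - 1) h) g = cochain_inner X (i - 1) h (boundary X i g)"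
proof -
  have "cochain_inner X i (coboundary X (i - 1) h) g =
      (\<Sum>\<tau>\<in>ifaces X i. \<Sum>\<sigma>\<in>ifaces X (i - 1). incidence \<tau> \<sigma> * h \<sigma> * g \<tau>)"
    by (simp add: cochain_inner_def coboundary_def sum_distrib_right)
  also have "\<dots> = (\<Sum>\<sigma>\<in>ifaces X (i - 1). \<Sum>\<tau>\<in>ifaces X i. incidence \<tau> \<sigma> * h \<sigma> * g \<tau>)"
    by (rule sum.swap)
  also have "\<dots> = cochain_inner X (i - 1) h (boundary X i g)"
    by (simp add: boundary_eq[OF assms] cochain_inner_def sum_distrib_left mult_ac)
  finally show ?thesis .
qed

lemma boundary_mem: "boundary X i g \<in> cochains X (i - 1)" if "finite X"
  by (simp add: boundary_eq[OF that] cochains_def)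

lemma coboundaries_perp_eq_cycles:
  assumes "finite X"
  shows "coboundaries_perp X i = cycles X i"
proof -
  have "(\<forall>b\<in>coboundaries X i. cochain_inner X i f b = 0) \<longleftrightarrow> boundary X i f = (\<lambda>_. 0)" for f
  proof
    assume L: "\<forall>b\<in>coboundaries X i. cochain_inner X i f b = 0"
    let ?h = "boundary X i f"
    have h: "?h \<in> cochains X (i - 1)"
      by (rule boundary_mem[OF assms])
    then have "cochain_inner X i f (coboundary X (i - 1) ?h) = 0"
      using L by (simp add: coboundaries_def)
    then have "cochain_inner X (i - 1) ?h ?h = 0"
      using boundary_adjoint[OF assms, of i ?h f] by (simp add: cochain_inner_def mult.commute)
    then have "\<forall>\<sigma>\<in>ifaces X (i - 1). ?h \<sigma> = 0"
      using finite_ifaces[OF assms] by (simp add: cochain_inner_def sum_nonneg_eq_0_iff)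
    then show "?h = (\<lambda>_. 0)"
      using h by (auto simp: cochains_def)
  next
    assume R: "boundary X i f = (\<lambda>_. 0)"
    have "cochain_inner X i f (coboundary X (i - 1) h) = 0" for h
      using boundary_adjoint[OF assms, of i h f] R by (simp add: cochain_inner_def mult.commute)
    then show "\<forall>b\<in>coboundaries X i. cochain_inner X i f b = 0"
      by (auto simp: coboundaries_def)
  qed
  then show ?thesis
    by (simp add: coboundaries_perp_def cycles_def)
qed

lemma finite_cheeger_quotients:
  assumes "finite V"
  shows "finite (cheeger_quotient V X k ` {A. nonempty_partition V k A})"
proof (rule finite_subset)
  show "finite (cheeger_quotient V X k ` ({..k} \<rightarrow>\<^sub>E Pow V))"
    using assms by (intro finite_imageI finite_PiE) auto
  have "cheeger_quotient V X k A = cheeger_quotient V X k (restrict A {..k})" for A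
    by (simp add: cheeger_quotient_def rainbow_faces_def rainbow_completion_faces_def
        cong: conj_cong)
  moreover have "restrict A {..k} \<in> {..k} \<rightarrow>\<^sub>E Pow V" if "nonempty_partition V k A" for A
    using that by (auto simp: nonempty_partition_def)
  ultimately show "cheeger_quotient V X k ` {A. nonempty_partition V k A}
      \<subseteq> cheeger_quotient V X k ` ({..k} \<rightarrow>\<^sub>E Pow V)"
    by blast
qed

end

theory Submission
  imports Defs "HOL-Analysis.Convex" "HOL-Analysis.Function_Topology"
begin

text \<open>
  Colour each vertex by the index of its part, and let \<open>u\<close> be the \<open>(k - 1)\<close>-cochain that lives on the
  faces with colour set \<open>{1..k}\<close> and equals the sign of the permutation relating vertex order and
  colour order. On a \<open>k\<close>-face of the completion, \<open>\<delta> u\<close> is \<open>\<plusminus>1\<close> if the face is rainbow; otherwise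
  it is \<open>0\<close>, because the two facets obtained by deleting one of two equally coloured vertices cancel.
  Let \<open>z\<close> be the orthogonal projection of \<open>u\<close> to the cycles and \<open>f = \<partial> \<delta> u\<close>, formed in
  the completion; \<open>f\<close> is a cycle. Projecting changes neither \<open>\<delta> u\<close> on \<open>X\<close> nor \<open>\<langle>u, f\<rangle>\<close>, so
  \<open>\<parallel>\<delta> z\<parallel>\<^sup>2 = |F|\<close> and \<open>\<langle>z, f\<rangle> = |F\<^sup>\<partial>|\<close>. Since \<open>|f(\<sigma>)| \<le> d(\<sigma>)\<close>, double counting gives
  \<open>\<parallel>f\<parallel>\<^sup>2 \<le> C(X) |F\<^sup>\<partial>|\<close>, and by Cauchy--Schwarz the Rayleigh quotient of \<open>z\<close> is at most
  \<open>C(X) |F| / |F\<^sup>\<partial>|\<close>.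
\<close>

section \<open>Minimisation over subspaces of finitely supported functions\<close>

text \<open>First-order condition at a minimum: the polynomial in \<open>t\<close> is the increment
  of a quadratic functional along a line through a minimiser. It yields orthogonality both for
  projections and for eigenvectors.\<close>

lemma linear_coeff_eq_0_if_quadratic_nonneg:
  fixes b c :: real
  assumes "\<And>t. 0 \<le> 2 * t * b + t\<^sup>2 * c"
  shows "b = 0"
proof (rule ccontr)
  assume "b \<noteq> 0"
  \<comment> \<open>At \<open>t = - b / s\<close> the linear term dominates.\<close>
  define s where "s = \<bar>c\<bar> + 1"
  have "s > 0" "c < s" by (auto simp: s_def)
  have "0 \<le> 2 * (- b / s) * b + (- b / s)\<^sup>2 * c"
    by (rule assms)
  also have "\<dots> = b\<^sup>2 * (c - 2 * s) / s\<^sup>2"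
    using \<open>s > 0\<close> by (simp add: field_simps power2_eq_square)
  also have "\<dots> < 0"
    using \<open>b \<noteq> 0\<close> \<open>s > 0\<close> \<open>c < s\<close>
    by (intro divide_neg_pos mult_pos_neg) auto
  finally show False by simp
qed

lemma continuous_on_eval [continuous_intros]:
  "continuous_on A (\<lambda>f :: 'b \<Rightarrow> real. f x)"
  by (rule continuous_on_subset[OF continuous_on_product_coordinates subset_UNIV])

text \<open>Tychonoff: functions carry the product topology, and \<open>W\<close> is a closed subset
  of a product of compact intervals.\<close>

lemma compact_if_closed_pointwise_bounded:
  fixes W :: "('b \<Rightarrow> real) set"
  assumes "closed W" "\<And>f x. f \<in> W \<Longrightarrow> \<bar>f x\<bar> \<le> r"
  shows "compact W"
proof -
  have "compact (PiE UNIV (\<lambda>_ :: 'b. {- r..r}))"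
    using compactin_PiE[of "\<lambda>_. euclidean" UNIV "\<lambda>_ :: 'b. {- r..r}"]
    by (simp add: euclidean_product_topology)
  moreover have "W = PiE UNIV (\<lambda>_ :: 'b. {- r..r}) \<inter> W"
    using assms(2) by (force simp: PiE_UNIV_domain abs_le_iff)
  ultimately show ?thesis
    using compact_Int_closed[OF _ assms(1)] by metis
qed

lemma abs_le_if_sum_squares_le:
  fixes f :: "'b \<Rightarrow> real"
  assumes "finite S" "\<And>x. x \<notin> S \<Longrightarrow> f x = 0" "(\<Sum>x\<in>S. (f x)\<^sup>2) \<le> r\<^sup>2" "0 \<le> r"
  shows "\<bar>f x\<bar> \<le> r"
proof (cases "x \<in> S")
  case True
  have "(f x)\<^sup>2 \<le> (\<Sum>x\<in>S. (f x)\<^sup>2)"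
    using True assms(1) by (intro member_le_sum) auto
  then show ?thesis
    using assms(3,4) by (metis abs_le_square_iff abs_of_nonneg order_trans)
qed (use assms in auto)

text \<open>Models a finite-dimensional space of functions on \<open>S\<close>, extended by zero.
  Closedness in the product topology is an axiom, so that minimisers come from compactness and no
  basis is chosen.\<close>

locale closed_function_subspace =
  fixes S :: "'b set" and W :: "('b \<Rightarrow> real) set"
  assumes finite_support: "finite S"
    and supported: "f \<in> W \<Longrightarrow> x \<notin> S \<Longrightarrow> f x = 0"
    and zero_mem: "(\<lambda>_. 0) \<in> W"
    and add_scaled_mem: "f \<in> W \<Longrightarrow> g \<in> W \<Longrightarrow> (\<lambda>x. f x + t * g x) \<in> W"
    and closed: "closed W"
begin

lemma scaled_mem: "g \<in> W \<Longrightarrow> (\<lambda>x. t * g x) \<in> W"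
  using add_scaled_mem[OF zero_mem] by simp

text \<open>Compactness gives a point of \<open>W\<close> nearest to \<open>u\<close> on
  \<open>S\<close>; stationarity of the squared distance in each direction \<open>w\<close> is the
  orthogonality.\<close>

lemma orthogonal_projection_exists:
  "\<exists>z\<in>W. \<forall>w\<in>W. (\<Sum>x\<in>S. (u x - z x) * w x) = 0"
proof -
  define q where "q z = (\<Sum>x\<in>S. (u x - z x)\<^sup>2)" for z
  define a where "a = q (\<lambda>_. 0)"
  \<comment> \<open>With norms taken over \<open>S\<close>, points of the set \<open>D\<close> below
    satisfy \<open>|z|^2 \<le> 2 |u - z|^2 + 2 |u|^2 \<le> 4 a\<close>.\<close>
  define r where "r = 2 * sqrt a"
  have a: "0 \<le> a" by (simp add: a_def q_def sum_nonneg)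
  have cont: "continuous_on UNIV q"
    unfolding q_def by (intro continuous_intros)
  \<comment> \<open>The points at least as close to \<open>u\<close> as \<open>0\<close> is: a
    bounded set containing \<open>0\<close>, so a minimiser over it is one over all of
    \<open>W\<close>.\<close>
  define D where "D = {z \<in> W. q z \<le> a}"
  have "closed D"
    unfolding D_def
    using closed closed_Collect_le[OF cont continuous_on_const]
    by (simp add: Collect_conj_eq closed_Int)
  moreover have "\<bar>z x\<bar> \<le> r" if "z \<in> D" for z x
  proof (rule abs_le_if_sum_squares_le[OF finite_support])
    show "z y = 0" if "y \<notin> S" for y
      using supported that \<open>z \<in> D\<close> by (auto simp: D_def)
    have "(z x)\<^sup>2 \<le> 2 * (u x - z x)\<^sup>2 + 2 * (u x)\<^sup>2" for x
      using zero_le_power2[of "2 * u x - z x"] by (simp add: power2_eq_square algebra_simps)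
    then have "(\<Sum>x\<in>S. (z x)\<^sup>2) \<le> (\<Sum>x\<in>S. 2 * (u x - z x)\<^sup>2 + 2 * (u x)\<^sup>2)"
      by (rule sum_mono)
    also have "\<dots> = 2 * q z + 2 * a"
      by (simp add: q_def a_def sum.distrib sum_distrib_left)
    also have "\<dots> \<le> r\<^sup>2"
      using \<open>z \<in> D\<close> a by (simp add: D_def r_def power_mult_distrib)
    finally show "(\<Sum>x\<in>S. (z x)\<^sup>2) \<le> r\<^sup>2" .
  qed (simp add: r_def a)
  ultimately have "compact D"
    by (rule compact_if_closed_pointwise_bounded)
  moreover have "(\<lambda>_. 0) \<in> D"
    by (simp add: D_def zero_mem a_def)
  ultimately obtain z where z: "z \<in> D" "\<And>y. y \<in> D \<Longrightarrow> q z \<le> q y"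
    using continuous_attains_inf[of D q] continuous_on_subset[OF cont] by blast
  have min: "q z \<le> q y" if "y \<in> W" for y
    using z that by (cases "y \<in> D") (force simp: D_def)+
  have "(\<Sum>x\<in>S. (u x - z x) * w x) = 0" if w: "w \<in> W" for w
  proof (rule linear_coeff_eq_0_if_quadratic_nonneg)
    fix t :: real
    have "q z \<le> q (\<lambda>x. z x + (- t) * w x)"
      using z(1) w by (intro min add_scaled_mem) (auto simp: D_def)
    also have "\<dots> = q z + (2 * t * (\<Sum>x\<in>S. (u x - z x) * w x) + t\<^sup>2 * (\<Sum>x\<in>S. (w x)\<^sup>2))"
      unfolding q_def sum_distrib_left sum.distrib[symmetric]
      by (rule sum.cong) (auto simp: power2_eq_square algebra_simps)
    finally show "0 \<le> 2 * t * (\<Sum>x\<in>S. (u x - z x) * w x) + t\<^sup>2 * (\<Sum>x\<in>S. (w x)\<^sup>2)"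
      by simp
  qed
  then show ?thesis
    using z(1) by (auto simp: D_def)
qed

text \<open>\<open>q\<close> has a minimum on the compact unit sphere of \<open>W\<close>, and
  homogeneity of degree 2 extends the inequality to all of \<open>W\<close>. The hypothesis
  \<open>nontrivial\<close> makes the sphere nonempty.\<close>

lemma rayleigh_quotient_attains_min:
  assumes cont: "continuous_on UNIV q"
    and hom: "\<And>t f. q (\<lambda>x. t * f x) = t\<^sup>2 * q f"
    and nontrivial: "f\<^sub>0 \<in> W" "f\<^sub>0 \<noteq> (\<lambda>_. 0)"
  obtains z where "z \<in> W" "(\<Sum>x\<in>S. (z x)\<^sup>2) = 1"
    "\<And>f. f \<in> W \<Longrightarrow> q z * (\<Sum>x\<in>S. (f x)\<^sup>2) \<le> q f"
proof -
  define N where "N f = (\<Sum>x\<in>S. (f x)\<^sup>2)" for f :: "'b \<Rightarrow> real"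
  have contN: "continuous_on UNIV N"
    unfolding N_def by (intro continuous_intros)
  have N0: "f = (\<lambda>_. 0)" if "f \<in> W" "N f = 0" for f
    using that finite_support supported by (fastforce simp: N_def sum_nonneg_eq_0_iff)
  have N_nonneg: "0 \<le> N f" for f
    by (simp add: N_def sum_nonneg)
  define D where "D = {f \<in> W. N f = 1}"
  have "closed D"
    unfolding D_def
    using closed closed_Collect_eq[OF contN continuous_on_const]
    by (simp add: Collect_conj_eq closed_Int)
  moreover have "\<bar>f x\<bar> \<le> 1" if "f \<in> D" for f x
    using that supported
    by (intro abs_le_if_sum_squares_le[OF finite_support]) (auto simp: D_def N_def)
  ultimately have "compact D"
    by (rule compact_if_closed_pointwise_bounded)
  have normalize: "(\<lambda>x. (1 / sqrt (N f)) * f x) \<in> D" if "f \<in> W" "f \<noteq> (\<lambda>_. 0)" for f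
  proof -
    have "0 < N f" using that N0 N_nonneg[of f] by fastforce
    have "N (\<lambda>x. (1 / sqrt (N f)) * f x) = (1 / sqrt (N f))\<^sup>2 * N f"
      by (simp only: N_def power_mult_distrib sum_distrib_left)
    also have "\<dots> = 1"
      using \<open>0 < N f\<close> by (simp add: power_divide)
    finally show ?thesis
      using that(1) scaled_mem by (simp only: D_def) blast
  qed
  obtain z where z: "z \<in> D" "\<And>y. y \<in> D \<Longrightarrow> q z \<le> q y"
    using continuous_attains_inf[OF \<open>compact D\<close>, of q] continuous_on_subset[OF cont]
      normalize[OF nontrivial] by blast
  have "q z * N f \<le> q f" if "f \<in> W" for f
  proof (cases "f = (\<lambda>_. 0)")
    case True
    then show ?thesis using hom[of 0 f] by (simp add: N_def)
  next
    case False
    have "0 < N f" using that False N0 N_nonneg[of f] by fastforce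
    have "q z \<le> (1 / sqrt (N f))\<^sup>2 * q f"
      using z(2)[OF normalize[OF that False]] hom by metis
    then show ?thesis
      using \<open>0 < N f\<close> by (simp add: power_divide field_simps)
  qed
  then show ?thesis
    using that[of z] z(1) by (simp add: D_def N_def)
qed

end

section \<open>Cycles and the Rayleigh quotient\<close>

lemma incidence_remove:
  assumes "v \<in> \<tau>"
  shows "incidence \<tau> (\<tau> - {v}) = (- 1) ^ card {u \<in> \<tau>. u < v}"
proof -
  have "\<tau> - (\<tau> - {v}) = {v}" using assms by auto
  then show ?thesis using assms by (auto simp: incidence_def)
qed

text \<open>Incidences vanish off the facets, and distinct vertices give distinct facets. The
  hypotheses ask for the facets of \<open>\<tau>\<close> to lie in \<open>S\<close>, so
  \<open>\<tau>\<close> may be a face of the completion while \<open>S\<close> consists of faces of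
  \<open>X\<close>.\<close>

lemma sum_incidence_facets:
  fixes h :: "'a::linorder set \<Rightarrow> real"
  assumes "finite S" "\<And>v. v \<in> \<tau> \<Longrightarrow> \<tau> - {v} \<in> S"
  shows "(\<Sum>\<sigma>\<in>S. incidence \<tau> \<sigma> * h \<sigma>)
       = (\<Sum>v\<in>\<tau>. (- 1) ^ card {u \<in> \<tau>. u < v} * h (\<tau> - {v}))"
proof -
  have inj: "inj_on (\<lambda>v. \<tau> - {v}) \<tau>" by (auto simp: inj_on_def)
  have "(\<Sum>\<sigma>\<in>S. incidence \<tau> \<sigma> * h \<sigma>) = (\<Sum>\<sigma>\<in>(\<lambda>v. \<tau> - {v}) ` \<tau>. incidence \<tau> \<sigma> * h \<sigma>)"
    using assms by (intro sum.mono_neutral_right) (auto simp: incidence_def)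
  also have "\<dots> = (\<Sum>v\<in>\<tau>. incidence \<tau> (\<tau> - {v}) * h (\<tau> - {v}))"
    by (simp add: sum.reindex[OF inj])
  finally show ?thesis
    by (simp add: incidence_remove)
qed

lemma facet_mem_ifaces:
  assumes "\<tau> \<in> ifaces Y (i + 1)" "v \<in> \<tau>" "finite \<tau>" "\<tau> - {v} \<in> X"
  shows "\<tau> - {v} \<in> ifaces X i"
proof -
  have "card \<tau> > 0" using assms card_gt_0_iff by blast
  then show ?thesis using assms by (auto simp: ifaces_def)
qed

text \<open>The matrix form of \<open>\<partial>\<partial> = 0\<close>. A set
  \<open>\<rho> = \<tau> - {x, y}\<close> is reached through exactly two facets, with opposite
  signs; any other \<open>\<rho>\<close> contributes nothing.\<close>

lemma sum_incidence_incidence: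
  fixes \<tau> :: "'a::linorder set"
  assumes "finite S" "finite \<tau>" "\<And>v. v \<in> \<tau> \<Longrightarrow> \<tau> - {v} \<in> S"
  shows "(\<Sum>\<sigma>\<in>S. incidence \<tau> \<sigma> * incidence \<sigma> \<rho>) = 0"
proof -
  have *: "(\<Sum>\<sigma>\<in>S. incidence \<tau> \<sigma> * incidence \<sigma> \<rho>)
      = (\<Sum>v\<in>\<tau>. (- 1) ^ card {u \<in> \<tau>. u < v} * incidence (\<tau> - {v}) \<rho>)"
    using sum_incidence_facets[OF assms(1,3)] .
  show ?thesis
  proof (cases "\<exists>x\<in>\<tau>. \<exists>y\<in>\<tau>. x \<noteq> y \<and> \<rho> = \<tau> - {x, y}")
    case False
    then have "incidence (\<tau> - {v}) \<rho> = 0" if "v \<in> \<tau>" for v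
      using that unfolding incidence_def by (auto simp: insert_commute Diff_insert2[symmetric])
    then show ?thesis by (simp add: *)
  next
    case True
    then obtain x y where xy: "x \<in> \<tau>" "y \<in> \<tau>" "x < y" "\<rho> = \<tau> - {x, y}"
      by (metis insert_commute neq_iff)
    have "incidence (\<tau> - {v}) \<rho> = 0" if "v \<in> \<tau> - {x, y}" for v
      using that xy unfolding incidence_def by auto
    then have "(\<Sum>v\<in>\<tau>. (- 1) ^ card {u \<in> \<tau>. u < v} * incidence (\<tau> - {v}) \<rho>)
        = (\<Sum>v\<in>{x, y}. (- 1) ^ card {u \<in> \<tau>. u < v} * incidence (\<tau> - {v}) \<rho>)"
      using xy assms(2) by (intro sum.mono_neutral_right) auto
    also have "\<dots> = (- 1) ^ card {u \<in> \<tau>. u < x} * incidence (\<tau> - {x}) \<rho>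
        + (- 1) ^ card {u \<in> \<tau>. u < y} * incidence (\<tau> - {y}) \<rho>"
      using xy by simp
    also have "incidence (\<tau> - {x}) \<rho> = (- 1) ^ card {u \<in> \<tau> - {x}. u < y}"
      using incidence_remove[of y "\<tau> - {x}"] xy by (simp add: Diff_insert2[symmetric] insert_commute)
    also have "incidence (\<tau> - {y}) \<rho> = (- 1) ^ card {u \<in> \<tau> - {y}. u < x}"
      using incidence_remove[of x "\<tau> - {y}"] xy by (simp add: Diff_insert2[symmetric] insert_commute)
    also have "{u \<in> \<tau> - {y}. u < x} = {u \<in> \<tau>. u < x}"
      using xy by auto
    \<comment> \<open>Deleting the smaller vertex \<open>x\<close> lowers the position of
      \<open>y\<close> by one, while deleting \<open>y\<close> leaves that of \<open>x\<close>
      alone; hence the cancellation.\<close>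
    also have "{u \<in> \<tau>. u < y} = insert x {u \<in> \<tau> - {x}. u < y}"
      using xy by auto
    also have "card \<dots> = Suc (card {u \<in> \<tau> - {x}. u < y})"
      using assms(2) by simp
    finally show ?thesis by (simp add: *)
  qed
qed

lemma mem_cycles_iff:
  assumes "finite X"
  shows "f \<in> cycles X i \<longleftrightarrow> (\<forall>\<sigma>. \<sigma> \<notin> ifaces X i \<longrightarrow> f \<sigma> = 0) \<and>
    (\<forall>\<rho>. \<rho> \<in> ifaces X (i - 1) \<longrightarrow> (\<Sum>\<sigma>\<in>ifaces X i. incidence \<sigma> \<rho> * f \<sigma>) = 0)"
  unfolding cycles_def cochains_def boundary_eq[OF assms] by (auto simp: fun_eq_iff)

text \<open>Cycles are cut out by linear equations, each in finitely many coordinates, and such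
  equations define closed sets in the product topology.\<close>

lemma closed_function_subspace_cycles:
  assumes "finite X"
  shows "closed_function_subspace (ifaces X i) (cycles X i)"
proof
  show "finite (ifaces X i)" by (rule finite_ifaces[OF assms])
  show "closed (cycles X i)"
  proof -
    have "cycles X i = {f. \<forall>\<sigma>. \<sigma> \<notin> ifaces X i \<longrightarrow> f \<sigma> = 0} \<inter>
        {f. \<forall>\<rho>. \<rho> \<in> ifaces X (i - 1) \<longrightarrow> (\<Sum>\<sigma>\<in>ifaces X i. incidence \<sigma> \<rho> * f \<sigma>) = 0}"
      using mem_cycles_iff[OF assms] by blast
    also have "closed \<dots>"
      by (intro closed_Int closed_Collect_all closed_Collect_imp open_Collect_const
          closed_Collect_eq continuous_intros)
    finally show ?thesis .
  qed
  show "(\<lambda>x. f x + t * g x) \<in> cycles X i" if "f \<in> cycles X i" "g \<in> cycles X i" for f g t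
  proof -
    have "(\<Sum>\<sigma>\<in>ifaces X i. incidence \<sigma> \<rho> * (f \<sigma> + t * g \<sigma>))
      = (\<Sum>\<sigma>\<in>ifaces X i. incidence \<sigma> \<rho> * f \<sigma>) + t * (\<Sum>\<sigma>\<in>ifaces X i. incidence \<sigma> \<rho> * g \<sigma>)" for \<rho>
      by (simp add: sum_distrib_left sum.distrib algebra_simps)
    then show ?thesis
      using that by (simp add: mem_cycles_iff[OF assms])
  qed
qed (simp_all add: mem_cycles_iff[OF assms])

text \<open>Boundaries are cycles, by \<open>sum_incidence_incidence\<close>. \<open>T\<close> is
  any set of finite sets with all facets in \<open>X\<close>; it is instantiated both with the faces
  of \<open>X\<close> and with those of the completion.\<close>

lemma sum_incidence_mem_cycles:
  assumes "finite X" "\<And>\<tau>. \<tau> \<in> T \<Longrightarrow> finite \<tau>"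
    and "\<And>\<tau> v. \<tau> \<in> T \<Longrightarrow> v \<in> \<tau> \<Longrightarrow> \<tau> - {v} \<in> ifaces X i"
  shows "(\<lambda>\<sigma>. if \<sigma> \<in> ifaces X i then \<Sum>\<tau>\<in>T. incidence \<tau> \<sigma> * g \<tau> else 0) \<in> cycles X i"
proof -
  have "(\<Sum>\<sigma>\<in>ifaces X i. incidence \<sigma> \<rho> * (\<Sum>\<tau>\<in>T. incidence \<tau> \<sigma> * g \<tau>)) = 0" for \<rho>
  proof -
    have "(\<Sum>\<sigma>\<in>ifaces X i. incidence \<sigma> \<rho> * (\<Sum>\<tau>\<in>T. incidence \<tau> \<sigma> * g \<tau>))
        = (\<Sum>\<tau>\<in>T. \<Sum>\<sigma>\<in>ifaces X i. g \<tau> * (incidence \<tau> \<sigma> * incidence \<sigma> \<rho>))"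
      unfolding sum_distrib_left by (subst sum.swap) (simp add: mult_ac)
    also have "\<dots> = 0"
      using sum_incidence_incidence[OF finite_ifaces[OF assms(1)] assms(2,3)]
      by (simp add: sum_distrib_left[symmetric])
    finally show ?thesis .
  qed
  then show ?thesis
    by (simp add: mem_cycles_iff[OF assms(1)])
qed

lemma up_laplacian_mem_cycles:
  assumes "abstract_complex V X"
  shows "up_laplacian X i f \<in> cycles X i"
proof -
  have fin: "finite X" by (rule abstract_complex_finite[OF assms])
  have "finite \<tau>" if "\<tau> \<in> X" for \<tau>
    using assms that finite_subset by (auto simp: abstract_complex_def)
  then have 1: "finite \<tau>" if "\<tau> \<in> ifaces X (i + 1)" for \<tau>
    using that by (simp add: ifaces_def)
  have "\<tau> - {v} \<in> X" if "\<tau> \<in> X" for \<tau> v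
    using assms that by (auto simp: abstract_complex_def)
  then have "\<tau> - {v} \<in> ifaces X i" if "\<tau> \<in> ifaces X (i + 1)" "v \<in> \<tau>" for \<tau> v
    using that by (intro facet_mem_ifaces[OF that 1[OF that(1)]]) (simp add: ifaces_def)
  from sum_incidence_mem_cycles[OF fin 1 this]
  show ?thesis
    by (simp add: up_laplacian_def boundary_eq[OF fin])
qed

section \<open>The spectral gap as the minimal Rayleigh quotient on cycles\<close>

lemma inner_coboundary_coboundary:
  assumes "finite X"
  shows "cochain_inner X (i + 1) (coboundary X i f) (coboundary X i g)
       = cochain_inner X i f (up_laplacian X i g)"
  using boundary_adjoint[OF assms, of "i + 1" f "coboundary X i g"]
  by (simp add: up_laplacian_def)

lemma coboundary_add_scaled:
  "coboundary X i (\<lambda>x. f x + t * g x) = (\<lambda>\<tau>. coboundary X i f \<tau> + t * coboundary X i g \<tau>)"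
  by (auto simp: coboundary_def fun_eq_iff sum.distrib sum_distrib_left algebra_simps)

lemma inner_add_scaled:
  "cochain_inner X i (\<lambda>x. f x + t * g x) (\<lambda>x. f x + t * g x)
   = cochain_inner X i f f + 2 * t * cochain_inner X i f g + t\<^sup>2 * cochain_inner X i g g"
  unfolding cochain_inner_def sum_distrib_left sum.distrib[symmetric]
  by (rule sum.cong) (auto simp: power2_eq_square algebra_simps)

lemma inner_self_eq_0_iff:
  assumes "finite X" "f \<in> cochains X i"
  shows "cochain_inner X i f f = 0 \<longleftrightarrow> f = (\<lambda>_. 0)"
proof
  assume "cochain_inner X i f f = 0"
  then have "\<forall>\<sigma>\<in>ifaces X i. f \<sigma> = 0"
    using finite_ifaces[OF assms(1)] by (simp add: cochain_inner_def sum_nonneg_eq_0_iff)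
  then show "f = (\<lambda>_. 0)"
    using assms(2) by (auto simp: cochains_def)
qed (simp add: cochain_inner_def)

lemma inner_self_nonneg: "0 \<le> cochain_inner X i f f"
  by (simp add: cochain_inner_def sum_nonneg)

lemma cycles_cochains: "f \<in> cycles X i \<Longrightarrow> f \<in> cochains X i"
  by (simp add: cycles_def)

text \<open>A minimiser \<open>z\<close> of the Rayleigh quotient on cycles is an eigenvector with
  eigenvalue \<open>q z\<close>. Any other eigenvalue is the Rayleigh quotient of its own
  eigenvector, hence at least \<open>q z\<close>. So the \<open>LEAST\<close> exists and equals
  \<open>q z\<close>.\<close>

lemma spectral_gap_rayleigh:
  assumes X: "abstract_complex V X" and f: "f \<in> cycles X (int k - 1)"
  shows "spectral_gap X k * cochain_inner X (int k - 1) f f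
    \<le> cochain_inner X (int k) (coboundary X (int k - 1) f) (coboundary X (int k - 1) f)"
proof (cases "f = (\<lambda>_. 0)")
  \<comment> \<open>This case absorbs a trivial cycle space, where there is no eigenvalue and
    \<open>LEAST\<close> is unspecified.\<close>
  case True
  then show ?thesis
    by (simp add: cochain_inner_def sum_nonneg)
next
  case False
  define i where "i = int k - 1"
  have fin: "finite X" by (rule abstract_complex_finite[OF X])
  interpret closed_function_subspace "ifaces X i" "cycles X i"
    by (rule closed_function_subspace_cycles[OF fin])
  define q where "q f = cochain_inner X (i + 1) (coboundary X i f) (coboundary X i f)" for f
  have q_L: "q f = cochain_inner X i f (up_laplacian X i f)" for f
    unfolding q_def by (rule inner_coboundary_coboundary[OF fin])
  have "q = (\<lambda>f. \<Sum>\<tau>\<in>ifaces X (i + 1). (\<Sum>\<sigma>\<in>ifaces X i. incidence \<tau> \<sigma> * f \<sigma>)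
      * (\<Sum>\<sigma>\<in>ifaces X i. incidence \<tau> \<sigma> * f \<sigma>))"
    by (auto simp: q_def cochain_inner_def coboundary_def)
  then have cont: "continuous_on UNIV q"
    by (simp only:) (intro continuous_intros)
  have hom: "q (\<lambda>x. t * f x) = t\<^sup>2 * q f" for t f
  proof -
    have 0: "coboundary X i (\<lambda>_. 0) = (\<lambda>_. 0)"
      by (simp add: coboundary_def fun_eq_iff)
    show ?thesis
      using coboundary_add_scaled[of X i "\<lambda>_. 0" t f]
        inner_add_scaled[of X "i + 1" "\<lambda>_. 0" t "coboundary X i f"]
      by (simp add: q_def 0) (simp add: cochain_inner_def)
  qed
  have N: "(\<Sum>x\<in>ifaces X i. (f x)\<^sup>2) = cochain_inner X i f f" for f
    by (simp add: cochain_inner_def power2_eq_square)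
  have "f \<in> cycles X i"
    using f by (simp add: i_def)
  then obtain z where z: "z \<in> cycles X i" "cochain_inner X i z z = 1"
    "\<And>f. f \<in> cycles X i \<Longrightarrow> q z * cochain_inner X i f f \<le> q f"
    using rayleigh_quotient_attains_min[OF cont hom _ False] unfolding N by blast
  \<comment> \<open>The residual of the eigenvalue equation. It is itself a cycle, so orthogonality
    to all cycles forces it to vanish.\<close>
  define u where "u = (\<lambda>\<sigma>. up_laplacian X i z \<sigma> + (- q z) * z \<sigma>)"
  have u: "u \<in> cycles X i"
    unfolding u_def by (intro add_scaled_mem up_laplacian_mem_cycles[OF X] z)
  have orth: "cochain_inner X i w u = 0" if w: "w \<in> cycles X i" for w
  proof -
    have "cochain_inner X (i + 1) (coboundary X i z) (coboundary X i w)
        - q z * cochain_inner X i z w = 0" (is "?b = 0")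
    proof (rule linear_coeff_eq_0_if_quadratic_nonneg)
      fix t
      \<comment> \<open>Minimality of \<open>z\<close> along the line in direction \<open>w\<close>;
        the constant term of the expansion cancels because \<open>z\<close> has norm 1.\<close>
      have "0 \<le> q (\<lambda>x. z x + t * w x)
          - q z * cochain_inner X i (\<lambda>x. z x + t * w x) (\<lambda>x. z x + t * w x)"
        using z(3) add_scaled_mem z(1) w by simp
      also have "\<dots> = 2 * t * ?b + t\<^sup>2 * (q w - q z * cochain_inner X i w w)"
        unfolding inner_add_scaled q_def coboundary_add_scaled z(2) by (simp add: algebra_simps)
      finally show "0 \<le> \<dots>" .
    qed
    moreover have "cochain_inner X (i + 1) (coboundary X i z) (coboundary X i w)
        = cochain_inner X i w (up_laplacian X i z)"
      using inner_coboundary_coboundary[OF fin, of i w z] by (simp add: cochain_inner_def mult_ac)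
    moreover have "cochain_inner X i w u
        = cochain_inner X i w (up_laplacian X i z) - q z * cochain_inner X i z w"
      by (simp add: u_def cochain_inner_def sum_distrib_left sum_subtractf algebra_simps)
    ultimately show ?thesis by simp
  qed
  have "u = (\<lambda>_. 0)"
    using orth[OF u] inner_self_eq_0_iff[OF fin cycles_cochains[OF u]] by simp
  then have "up_laplacian X i z = (\<lambda>\<sigma>. q z * z \<sigma>)"
    by (simp add: u_def fun_eq_iff)
  moreover have "z \<noteq> (\<lambda>_. 0)"
    using z(2) by (auto simp: cochain_inner_def)
  ultimately have "is_eigenvalue_on (coboundaries_perp X i) (up_laplacian X i) (q z)"
    using z(1) unfolding is_eigenvalue_on_def coboundaries_perp_eq_cycles[OF fin] by blast
  moreover have "q z \<le> \<nu>"
    if "is_eigenvalue_on (coboundaries_perp X i) (up_laplacian X i) \<nu>" for \<nu>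
  proof -
    obtain g where g: "g \<in> cycles X i" "g \<noteq> (\<lambda>_. 0)" "up_laplacian X i g = (\<lambda>x. \<nu> * g x)"
      using \<open>is_eigenvalue_on _ _ \<nu>\<close>
      unfolding is_eigenvalue_on_def coboundaries_perp_eq_cycles[OF fin] by blast
    have "0 < cochain_inner X i g g"
      using inner_self_eq_0_iff[OF fin cycles_cochains[OF g(1)]] g(2) inner_self_nonneg
      by (metis order_le_less)
    moreover have "q g = \<nu> * cochain_inner X i g g"
      unfolding q_L g(3) by (simp add: cochain_inner_def sum_distrib_left mult_ac)
    ultimately show ?thesis
      using z(3)[OF g(1)] by simp
  qed
  ultimately have "spectral_gap X k = q z"
    unfolding spectral_gap_def i_def by (intro Least_equality)
  then show ?thesis
    using z(3)[OF \<open>f \<in> cycles X i\<close>] by (simp add: q_def i_def)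
qed

section \<open>Signs of colourings\<close>

text \<open>A product over ordered pairs: the condition on colours makes each inversion count once,
  and pairs of equal colour contribute 1.\<close>

definition colour_sign :: "('a::linorder \<Rightarrow> nat) \<Rightarrow> 'a set \<Rightarrow> real" where
  "colour_sign c \<sigma> = (\<Prod>x\<in>\<sigma>. \<Prod>y\<in>\<sigma>. if c x < c y \<and> y < x then - 1 else 1)"

lemma colour_sign_square: "(colour_sign c \<sigma>)\<^sup>2 = 1"
  unfolding colour_sign_def prod_power_distrib by (intro prod.neutral ballI) auto

lemma colour_sign_insert:
  assumes "finite \<rho>" "u \<notin> \<rho>"
  shows "colour_sign c (insert u \<rho>) = colour_sign c \<rho> *
    (\<Prod>w\<in>\<rho>. (if c u < c w \<and> w < u then - 1 else 1) * (if c w < c u \<and> u < w then - 1 else 1))"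
  using assms by (simp add: colour_sign_def prod.distrib)

lemma minus_one_power_card_filter:
  assumes "finite \<rho>"
  shows "(- 1) ^ card {w \<in> \<rho>. P w} = (\<Prod>w\<in>\<rho>. if P w then - 1 else (1 :: real))"
  using assms by (simp add: prod.If_cases Int_def)

text \<open>Compare the two terms vertex by vertex. Exchanging \<open>v\<close> for \<open>u\<close>
  changes the inversion with \<open>w\<close> exactly when \<open>w\<close> lies between
  \<open>u\<close> and \<open>v\<close>, and then the position count changes by \<open>w\<close> as
  well. What remains is one sign, since \<open>u\<close> itself lies below \<open>v\<close>.\<close>

lemma colour_sign_cancel:
  fixes c :: "'a::linorder \<Rightarrow> nat"
  assumes "finite \<tau>" "u \<in> \<tau>" "v \<in> \<tau>" "u < v" "c u = c v"
    and "\<And>w. w \<in> \<tau> - {u, v} \<Longrightarrow> c w \<noteq> c u"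
  shows "(- 1) ^ card {w \<in> \<tau>. w < u} * colour_sign c (\<tau> - {u})
       + (- 1) ^ card {w \<in> \<tau>. w < v} * colour_sign c (\<tau> - {v}) = 0"
proof -
  define \<rho> where "\<rho> = \<tau> - {u, v}"
  have \<rho>: "finite \<rho>" "u \<notin> \<rho>" "v \<notin> \<rho>" "\<tau> - {u} = insert v \<rho>" "\<tau> - {v} = insert u \<rho>"
    using assms by (auto simp: \<rho>_def)
  have u: "{w \<in> \<tau>. w < u} = {w \<in> \<rho>. w < u}" and v: "{w \<in> \<tau>. w < v} = insert u {w \<in> \<rho>. w < v}"
    using assms(2-4) by (auto simp: \<rho>_def)
  have "card {w \<in> \<tau>. w < v} = Suc (card {w \<in> \<rho>. w < v})"
    unfolding v using \<rho> by simp
  moreover have "(- 1) ^ card {w \<in> \<rho>. w < u} *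
        (\<Prod>w\<in>\<rho>. (if c v < c w \<and> w < v then - 1 else 1) * (if c w < c v \<and> v < w then - 1 else 1))
      = (- 1) ^ card {w \<in> \<rho>. w < v} *
        (\<Prod>w\<in>\<rho>. (if c u < c w \<and> w < u then - 1 else 1) * (if c w < c u \<and> u < w then - 1 else (1::real)))"
    unfolding minus_one_power_card_filter[OF \<rho>(1)] prod.distrib[symmetric]
  proof (rule prod.cong)
    fix w assume "w \<in> \<rho>"
    then have "w \<noteq> u" "w \<noteq> v" "c w \<noteq> c v" using assms(5,6) by (auto simp: \<rho>_def)
    then show "(if w < u then - 1 else 1) *
        ((if c v < c w \<and> w < v then - 1 else 1) * (if c w < c v \<and> v < w then - 1 else 1))
      = (if w < v then - 1 else 1) *
        ((if c u < c w \<and> w < u then - 1 else 1) * (if c w < c u \<and> u < w then - 1 else (1::real)))"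
      using assms(5) by (cases "w < u"; cases "w < v"; cases "c w < c v") auto
  qed simp
  ultimately show ?thesis
    using u by (simp add: \<rho> colour_sign_insert algebra_simps)
qed

text \<open>A rainbow \<open>\<tau>\<close> has one contributing facet, opposite its vertex of
  colour 0. Otherwise there are no contributing facets or exactly two, opposite two vertices of
  equal colour, and these cancel. Squaring discards the sign of the rainbow case.\<close>

lemma alternating_sum_colour_sign:
  fixes c :: "'a::linorder \<Rightarrow> nat"
  assumes "finite \<tau>" and colours: "c ` \<tau> \<subseteq> {..k}"
  shows "(\<Sum>v\<in>\<tau>. (- 1) ^ card {w \<in> \<tau>. w < v} *
      (if bij_betw c (\<tau> - {v}) {1..k} then colour_sign c (\<tau> - {v}) else 0))\<^sup>2
    = (if bij_betw c \<tau> {..k} then 1 else 0)" (is "(\<Sum>v\<in>\<tau>. ?s v)\<^sup>2 = _")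
proof -
  \<comment> \<open>The vertices whose deletion leaves a nonzero term.\<close>
  define G where "G = {v \<in> \<tau>. bij_betw c (\<tau> - {v}) {1..k}}"
  have G: "(\<Sum>v\<in>\<tau>. ?s v) = (\<Sum>v\<in>G. (- 1) ^ card {w \<in> \<tau>. w < v} * colour_sign c (\<tau> - {v}))"
    using assms(1) by (intro sum.mono_neutral_cong_right) (auto simp: G_def)
  show ?thesis
  proof (cases "bij_betw c \<tau> {..k}")
    case True
    then obtain v where v: "v \<in> \<tau>" "c v = 0"
      by (metis atMost_iff bij_betw_iff_bijections zero_le)
    have "bij_betw c (\<tau> - {w}) ({..k} - {c w})" if "w \<in> \<tau>" for w
      using bij_betw_DiffI[OF True, of "{w}" "{c w}"] that True
      by (auto simp: bij_betw_def)
    then have *: "c ` (\<tau> - {w}) = {..k} - {c w}" if "w \<in> \<tau>" for w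
      using that by (auto simp: bij_betw_def)
    \<comment> \<open>Deleting \<open>w\<close> loses exactly the colour \<open>c w\<close>, which
      must therefore be 0.\<close>
    have "w = v" if "w \<in> G" for w
    proof -
      have "{..k} - {c w} = {1..k}"
        using that *[of w] by (auto simp: G_def bij_betw_def)
      moreover have "0 \<in> {..k}" "0 \<notin> {1..k}" by auto
      ultimately have "c w = 0" by (metis DiffI singletonD)
      then show ?thesis
        using True v that by (auto simp: G_def bij_betw_def inj_on_def)
    qed
    moreover have "{..k} - {0} = {1..k}" by auto
    then have "v \<in> G"
      using v \<open>\<And>w. w \<in> \<tau> \<Longrightarrow> bij_betw c (\<tau> - {w}) ({..k} - {c w})\<close>[of v] by (simp add: G_def)
    ultimately have "G = {v}" by blast
    then show ?thesis
      using True unfolding G by (simp add: power_mult_distrib colour_sign_square flip: power_mult)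
  next
    case False
    have "(\<Sum>v\<in>\<tau>. ?s v) = 0"
    proof (cases "G = {}")
      case True
      then show ?thesis unfolding G by simp
    next
      case nonempty: False
      then obtain u where u: "u \<in> \<tau>" "bij_betw c (\<tau> - {u}) {1..k}"
        by (auto simp: G_def)
      \<comment> \<open>The other vertices already carry each of the colours \<open>1..k\<close>, so
        colour 0 at \<open>u\<close> would make \<open>\<tau>\<close> rainbow. Hence
        \<open>u\<close> repeats the colour of some \<open>v\<close>.\<close>
      have "c u \<noteq> 0"
      proof
        assume "c u = 0"
        then have "bij_betw c (insert u (\<tau> - {u})) (insert 0 {1..k})"
          using notIn_Un_bij_betw[of u "\<tau> - {u}" c "{1..k}"] u(2) by simp
        moreover have "insert 0 {1..k} = {..k}" "insert u (\<tau> - {u}) = \<tau>" using u by auto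
        ultimately show False using False by simp
      qed
      then have "c u \<in> c ` (\<tau> - {u})"
        using u colours by (auto simp: bij_betw_def)
      then obtain v where v: "v \<in> \<tau>" "v \<noteq> u" "c v = c u"
        by (metis DiffD1 DiffD2 imageE singletonI)
      have other: "c w \<noteq> c u" if "w \<in> \<tau> - {u, v}" for w
        using inj_onD[of c "\<tau> - {u}" w v] that u v by (auto simp: bij_betw_def)
      have "bij_betw c (\<tau> - {v}) {1..k}"
      proof -
        have swap: "\<tau> - {v} = insert u (\<tau> - {u, v})" "\<tau> - {u} = insert v (\<tau> - {u, v})"
          using u v by auto
        then have "c ` (\<tau> - {v}) = c ` (\<tau> - {u})"
          using v by simp
        moreover have "c u \<notin> c ` (\<tau> - {u, v})"
          using other by (metis imageE)
        then have "inj_on c (\<tau> - {v})"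
          unfolding swap(1) using u(2) inj_on_subset[of c "\<tau> - {u}" "\<tau> - {u, v}"]
          by (auto simp: bij_betw_def)
        ultimately show ?thesis using u(2) by (auto simp: bij_betw_def)
      qed
      \<comment> \<open>Deleting any third vertex would keep both \<open>u\<close> and
        \<open>v\<close>, contradicting injectivity of the colours.\<close>
      moreover have "w = u \<or> w = v" if "w \<in> G" for w
        using inj_onD[of c "\<tau> - {w}" u v] that u v by (auto simp: G_def bij_betw_def)
      moreover have "v \<in> G \<and> u \<in> G"
        using u v calculation(1) by (simp add: G_def)
      ultimately have "G = {u, v}" by blast
      moreover have "(- 1) ^ card {w \<in> \<tau>. w < u} * colour_sign c (\<tau> - {u})
          + (- 1) ^ card {w \<in> \<tau>. w < v} * colour_sign c (\<tau> - {v}) = 0"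
      proof (cases u v rule: linorder_cases)
        case less
        show ?thesis
          by (rule colour_sign_cancel[OF assms(1) u(1) v(1) less v(3)[symmetric] other])
      next
        case greater
        have "c w \<noteq> c v" if "w \<in> \<tau> - {v, u}" for w
          using other that v(3) by (simp add: insert_commute)
        from colour_sign_cancel[OF assms(1) v(1) u(1) greater v(3) this]
        show ?thesis by (simp only: add.commute)
      qed (use v in simp)
      ultimately show ?thesis
        unfolding G using v(2) by simp
    qed
    then show ?thesis using False by simp
  qed
qed

section \<open>Rainbow faces\<close>

lemma partition_colouring_exists:
  assumes "nonempty_partition V k A"
  obtains c where "c ` V \<subseteq> {..k}" "\<And>v i. v \<in> V \<Longrightarrow> i \<le> k \<Longrightarrow> v \<in> A i \<longleftrightarrow> c v = i"
proof -
  have U: "(\<Union>i\<le>k. A i) = V" and disj: "disjoint_family_on A {..k}"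
    using assms by (auto simp: nonempty_partition_def)
  have "\<forall>v\<in>V. \<exists>i. i \<le> k \<and> v \<in> A i"
    using U by blast
  then obtain c where c: "\<forall>v\<in>V. c v \<le> k \<and> v \<in> A (c v)"
    by (rule bchoice[THEN exE])
  show ?thesis
  proof
    show "c ` V \<subseteq> {..k}" using c by auto
    show "v \<in> A i \<longleftrightarrow> c v = i" if "v \<in> V" "i \<le> k" for v i
      using disjoint_family_onD[OF disj, of i "c v"] c that by auto
  qed
qed

text \<open>Turns the condition on intersections into the bijectivity used in
  \<open>alternating_sum_colour_sign\<close>.\<close>

lemma rainbow_iff_bij_betw:
  assumes "c ` V \<subseteq> {..k}" "\<And>v i. v \<in> V \<Longrightarrow> i \<le> k \<Longrightarrow> v \<in> A i \<longleftrightarrow> c v = i" "\<tau> \<subseteq> V"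
  shows "(\<forall>i\<le>k. card (\<tau> \<inter> A i) = 1) \<longleftrightarrow> bij_betw c \<tau> {..k}"
proof -
  have eq: "\<tau> \<inter> A i = {v \<in> \<tau>. c v = i}" if "i \<le> k" for i
    using assms(2,3) that by blast
  show ?thesis
  proof
    assume L: "\<forall>i\<le>k. card (\<tau> \<inter> A i) = 1"
    have single: "\<exists>!v. v \<in> \<tau> \<and> c v = i" if "i \<le> k" for i
    proof -
      have "card {v \<in> \<tau>. c v = i} = 1"
        using L eq that by simp
      then obtain x where "{v \<in> \<tau>. c v = i} = {x}"
        by (rule card_1_singletonE)
      then show ?thesis by (intro ex1I[of _ x]) auto
    qed
    have "inj_on c \<tau>"
      using single assms(1,3) unfolding inj_on_def by (metis atMost_iff image_subset_iff subsetD)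
    moreover have "c ` \<tau> = {..k}"
      using assms(1,3) single by (auto simp: image_iff) blast
    ultimately show "bij_betw c \<tau> {..k}"
      by (simp add: bij_betw_def)
  next
    assume R: "bij_betw c \<tau> {..k}"
    show "\<forall>i\<le>k. card (\<tau> \<inter> A i) = 1"
    proof (intro allI impI)
      fix i assume i: "i \<le> k"
      then have "i \<in> c ` \<tau>"
        using R by (simp add: bij_betw_def)
      then obtain v where v: "v \<in> \<tau>" "c v = i" by blast
      then have "{w \<in> \<tau>. c w = i} = {v}"
        using R unfolding bij_betw_def inj_on_def by blast
      then show "card (\<tau> \<inter> A i) = 1"
        using eq[OF i] by simp
    qed
  qed
qed

lemma completion_face:
  assumes "abstract_complex V X" "\<tau> \<in> k_completion V X k"
  shows "\<tau> \<subseteq> V" "finite \<tau>" "v \<in> \<tau> \<Longrightarrow> \<tau> - {v} \<in> X"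
proof -
  show "\<tau> \<subseteq> V"
    using assms unfolding abstract_complex_def k_completion_def by blast
  then show "finite \<tau>"
    using assms(1) finite_subset unfolding abstract_complex_def by blast
  show "\<tau> - {v} \<in> X" if "v \<in> \<tau>"
  proof (cases "\<tau> \<in> X")
    case True
    then show ?thesis
      using assms(1) Diff_subset unfolding abstract_complex_def by blast
  next
    case False
    then show ?thesis
      using assms(2) that by (simp add: k_completion_def)
  qed
qed

text \<open>A completion face may be missing from \<open>X\<close>, but its facets are not; so
  boundaries of chains on the completion are cochains of \<open>X\<close>.\<close>

lemma completion_facet_mem_ifaces:
  assumes "abstract_complex V X" "\<tau> \<in> ifaces (k_completion V X k) (int k)" "v \<in> \<tau>"
  shows "\<tau> - {v} \<in> ifaces X (int k - 1)"
proof -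
  have "\<tau> \<in> k_completion V X k"
    using assms(2) by (simp add: ifaces_def)
  then show ?thesis
    using facet_mem_ifaces[of \<tau> "k_completion V X k" "int k - 1" v X] assms
      completion_face[OF assms(1)] by simp
qed

lemma finite_completion:
  assumes "abstract_complex V X"
  shows "finite (k_completion V X k)"
proof (rule finite_subset)
  show "k_completion V X k \<subseteq> Pow V"
    using completion_face(1)[OF assms] by blast
  show "finite (Pow V)"
    using assms by (simp add: abstract_complex_def)
qed

lemma rainbow_completion_faces_eq:
  "rainbow_completion_faces V X k A
   = {\<tau> \<in> ifaces (k_completion V X k) (int k). \<forall>i\<le>k. card (\<tau> \<inter> A i) = 1}"
  by (auto simp: rainbow_completion_faces_def ifaces_def)

lemma rainbow_faces_eq:
  "rainbow_faces X k A = {\<tau> \<in> ifaces X (int k). \<tau> \<in> rainbow_completion_faces V X k A}"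
  by (auto simp: rainbow_completion_faces_def rainbow_faces_def ifaces_def k_completion_def)

text \<open>Double counting of pairs \<open>\<sigma> \<subseteq> \<tau>\<close>: the
  \<open>(k - 1)\<close>-faces of \<open>X\<close> inside a rainbow \<open>\<tau>\<close> are
  exactly its facets.\<close>

lemma sum_rainbow_degree_square:
  assumes "abstract_complex V X"
  shows "(\<Sum>\<sigma>\<in>ifaces X (int k - 1). (rainbow_degree V X k A \<sigma>)\<^sup>2)
    = (\<Sum>\<tau>\<in>rainbow_completion_faces V X k A. \<Sum>v\<in>\<tau>. rainbow_degree V X k A (\<tau> - {v}))"
proof -
  let ?S = "ifaces X (int k - 1)" and ?R = "rainbow_completion_faces V X k A"
    and ?d = "rainbow_degree V X k A"
  have finS: "finite ?S"
    by (rule finite_ifaces[OF abstract_complex_finite[OF assms]])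
  have finR: "finite ?R"
    unfolding rainbow_completion_faces_def using finite_completion[OF assms] by simp
  \<comment> \<open>One factor of the square becomes the number of sets \<open>\<tau>\<close> summed
    over; the other stays as the summand.\<close>
  have "(\<Sum>\<sigma>\<in>?S. (?d \<sigma>)\<^sup>2) = (\<Sum>\<sigma>\<in>?S. \<Sum>\<tau>\<in>{\<tau> \<in> ?R. \<sigma> \<subseteq> \<tau>}. ?d \<sigma>)"
    by (simp add: power2_eq_square) (simp add: rainbow_degree_def)
  also have "\<dots> = (\<Sum>\<tau>\<in>?R. \<Sum>\<sigma>\<in>{\<sigma> \<in> ?S. \<sigma> \<subseteq> \<tau>}. ?d \<sigma>)"
    by (rule sum.swap_restrict[OF finS finR])
  also have "\<dots> = (\<Sum>\<tau>\<in>?R. \<Sum>v\<in>\<tau>. ?d (\<tau> - {v}))"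
  proof (rule sum.cong[OF refl])
    fix \<tau> assume \<tau>: "\<tau> \<in> ?R"
    then have face: "\<tau> \<in> ifaces (k_completion V X k) (int k)" and K: "\<tau> \<in> k_completion V X k"
      and card: "card \<tau> = k + 1"
      by (auto simp: rainbow_completion_faces_def ifaces_def)
    have "\<sigma> \<in> (\<lambda>v. \<tau> - {v}) ` \<tau>" if "\<sigma> \<in> ?S" "\<sigma> \<subseteq> \<tau>" for \<sigma>
    proof -
      have "card \<sigma> = k" using that(1) by (simp add: ifaces_def)
      then have "card (\<tau> - \<sigma>) = 1"
        using card that(2) completion_face(2)[OF assms K]
        by (simp add: card_Diff_subset finite_subset)
      then obtain v where "\<tau> - \<sigma> = {v}" by (rule card_1_singletonE)
      then have "v \<in> \<tau>" "\<sigma> = \<tau> - {v}" using that(2) by auto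
      then show ?thesis by blast
    qed
    then have "{\<sigma> \<in> ?S. \<sigma> \<subseteq> \<tau>} = (\<lambda>v. \<tau> - {v}) ` \<tau>"
      using completion_facet_mem_ifaces[OF assms face] by blast
    moreover have "inj_on (\<lambda>v. \<tau> - {v}) \<tau>" by (auto simp: inj_on_def)
    ultimately show "(\<Sum>\<sigma>\<in>{\<sigma> \<in> ?S. \<sigma> \<subseteq> \<tau>}. ?d \<sigma>) = (\<Sum>v\<in>\<tau>. ?d (\<tau> - {v}))"
      by (simp add: sum.reindex)
  qed
  finally show ?thesis .
qed

lemma abs_incidence_le: "\<bar>incidence \<tau> \<sigma>\<bar> \<le> (if \<sigma> \<subseteq> \<tau> then 1 else 0)"
  by (auto simp: incidence_def power_abs)

text \<open>The eigenvalue bound with denominators cleared, for one given partition. It combines the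
  Rayleigh inequality for \<open>z\<close> with Cauchy-Schwarz for \<open>z\<close> and
  \<open>f\<close>.\<close>

lemma spectral_gap_rainbow_bound:
  fixes V :: "'a::linorder set"
  assumes X: "abstract_complex V X" and A: "nonempty_partition V k A"
    and ne: "rainbow_completion_faces V X k A \<noteq> {}"
  shows "spectral_gap X k * card (rainbow_completion_faces V X k A)
    \<le> max_degree_sum V X k A * card (rainbow_faces X k A)"
proof -
  let ?i = "int k - 1"
  let ?S = "ifaces X ?i" and ?R = "rainbow_completion_faces V X k A"
    and ?d = "rainbow_degree V X k A" and ?T = "ifaces (k_completion V X k) (int k)"
    and ?C = "max_degree_sum V X k A"
  have finX: "finite X" by (rule abstract_complex_finite[OF X])
  have finS: "finite ?S" by (rule finite_ifaces[OF finX])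
  have finT: "finite ?T" by (rule finite_ifaces[OF finite_completion[OF X]])
  have RT: "?R \<subseteq> ?T" by (auto simp: rainbow_completion_faces_eq)
  then have finR: "finite ?R" using finT finite_subset by blast
  have T: "\<tau> \<subseteq> V" "finite \<tau>" if "\<tau> \<in> ?T" for \<tau>
    using that completion_face[OF X] by (auto simp: ifaces_def)
  note facet = completion_facet_mem_ifaces[OF X]
  obtain c where c: "c ` V \<subseteq> {..k}" "\<And>v i. v \<in> V \<Longrightarrow> i \<le> k \<Longrightarrow> v \<in> A i \<longleftrightarrow> c v = i"
    using partition_colouring_exists[OF A] by blast
  have R_iff: "\<tau> \<in> ?R \<longleftrightarrow> bij_betw c \<tau> {..k}" if "\<tau> \<in> ?T" for \<tau>
    using rainbow_iff_bij_betw[OF c T(1)[OF that]] that by (simp add: rainbow_completion_faces_eq)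
  define u where "u \<sigma> = (if bij_betw c \<sigma> {1..k} then colour_sign c \<sigma> else 0)" for \<sigma>
  \<comment> \<open>The coboundary of \<open>u\<close>, also evaluated on completion faces outside
    \<open>X\<close>.\<close>
  define g where "g \<tau> = (\<Sum>\<sigma>\<in>?S. incidence \<tau> \<sigma> * u \<sigma>)" for \<tau>
  have g: "(g \<tau>)\<^sup>2 = (if \<tau> \<in> ?R then 1 else 0)" if "\<tau> \<in> ?T" for \<tau>
  proof -
    have "g \<tau> = (\<Sum>v\<in>\<tau>. (- 1) ^ card {w \<in> \<tau>. w < v} * u (\<tau> - {v}))"
      unfolding g_def by (rule sum_incidence_facets[OF finS facet[OF that]])
    moreover have "c ` \<tau> \<subseteq> {..k}" using T(1)[OF that] c(1) by blast
    ultimately show ?thesis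
      using alternating_sum_colour_sign[OF T(2)[OF that], of c k] by (simp only: u_def R_iff[OF that])
  qed
  define f where "f = (\<lambda>\<sigma>. if \<sigma> \<in> ?S then \<Sum>\<tau>\<in>?T. incidence \<tau> \<sigma> * g \<tau> else 0)"
  have f_cycle: "f \<in> cycles X ?i"
    unfolding f_def using T(2) facet by (intro sum_incidence_mem_cycles[OF finX])
  interpret closed_function_subspace ?S "cycles X ?i"
    by (rule closed_function_subspace_cycles[OF finX])
  obtain z where z: "z \<in> cycles X ?i"
    and orth: "\<And>w. w \<in> cycles X ?i \<Longrightarrow> (\<Sum>x\<in>?S. (u x - z x) * w x) = 0"
    using orthogonal_projection_exists[of u] by blast

  \<comment> \<open>Adjointness: \<open>\<langle>u, \<partial> g\<rangle> = \<langle>\<delta> u,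
    g\<rangle>\<close>, where \<open>\<delta> u = g\<close> on \<open>?T\<close> and the square of
    \<open>g\<close> is the indicator of \<open>?R\<close>.\<close>
  have uf: "(\<Sum>\<sigma>\<in>?S. u \<sigma> * f \<sigma>) = card ?R"
  proof -
    have "(\<Sum>\<sigma>\<in>?S. u \<sigma> * f \<sigma>) = (\<Sum>\<sigma>\<in>?S. \<Sum>\<tau>\<in>?T. u \<sigma> * (incidence \<tau> \<sigma> * g \<tau>))"
      by (simp add: f_def sum_distrib_left)
    also have "\<dots> = (\<Sum>\<tau>\<in>?T. \<Sum>\<sigma>\<in>?S. u \<sigma> * (incidence \<tau> \<sigma> * g \<tau>))"
      by (rule sum.swap)
    also have "\<dots> = (\<Sum>\<tau>\<in>?T. (g \<tau>)\<^sup>2)"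
      by (rule sum.cong) (simp_all add: g_def power2_eq_square sum_distrib_right mult_ac)
    also have "\<dots> = (\<Sum>\<tau>\<in>?T. if \<tau> \<in> ?R then 1 else 0)"
      by (simp add: g)
    also have "\<dots> = card ?R"
      using finT RT by (simp add: sum.If_cases Int_absorb1)
    finally show ?thesis .
  qed
  have zf: "(\<Sum>\<sigma>\<in>?S. z \<sigma> * f \<sigma>) = card ?R"
    using orth[OF f_cycle] uf by (simp add: left_diff_distrib sum_subtractf)

  have norm_f: "(\<Sum>\<sigma>\<in>?S. (f \<sigma>)\<^sup>2) \<le> ?C * card ?R"
  proof -
    have g_le: "\<bar>g \<tau>\<bar> \<le> (if \<tau> \<in> ?R then 1 else 0)" if "\<tau> \<in> ?T" for \<tau>
      using g[OF that] by (auto simp: power2_eq_1_iff split: if_splits)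
    \<comment> \<open>Nonzero terms come from the rainbow faces containing \<open>\<sigma>\<close>,
      and each has modulus at most 1.\<close>
    have "\<bar>f \<sigma>\<bar> \<le> ?d \<sigma>" if "\<sigma> \<in> ?S" for \<sigma>
    proof -
      have "\<bar>f \<sigma>\<bar> \<le> (\<Sum>\<tau>\<in>?T. \<bar>incidence \<tau> \<sigma>\<bar> * \<bar>g \<tau>\<bar>)"
        using that sum_abs[of "\<lambda>\<tau>. incidence \<tau> \<sigma> * g \<tau>" ?T] by (simp add: f_def abs_mult)
      also have "\<dots> \<le> (\<Sum>\<tau>\<in>?T. (if \<sigma> \<subseteq> \<tau> then 1 else 0) * (if \<tau> \<in> ?R then 1 else 0))"
        by (intro sum_mono mult_mono abs_incidence_le g_le) auto
      also have "\<dots> = (\<Sum>\<tau>\<in>?T. if \<tau> \<in> {\<tau> \<in> ?R. \<sigma> \<subseteq> \<tau>} then 1 else 0)"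
        by (rule sum.cong) auto
      also have "\<dots> = card (?T \<inter> {\<tau> \<in> ?R. \<sigma> \<subseteq> \<tau>})"
        using finT by (simp add: sum.If_cases)
      also have "?T \<inter> {\<tau> \<in> ?R. \<sigma> \<subseteq> \<tau>} = {\<tau> \<in> ?R. \<sigma> \<subseteq> \<tau>}"
        using RT by blast
      finally show ?thesis by (simp add: rainbow_degree_def)
    qed
    then have "(f \<sigma>)\<^sup>2 \<le> (real (?d \<sigma>))\<^sup>2" if "\<sigma> \<in> ?S" for \<sigma>
      using that by (metis abs_ge_zero power2_abs power_mono)
    then have "(\<Sum>\<sigma>\<in>?S. (f \<sigma>)\<^sup>2) \<le> (\<Sum>\<sigma>\<in>?S. (real (?d \<sigma>))\<^sup>2)"
      by (rule sum_mono)
    also have "\<dots> = real (\<Sum>\<tau>\<in>?R. \<Sum>v\<in>\<tau>. ?d (\<tau> - {v}))"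
      unfolding sum_rainbow_degree_square[OF X, symmetric] by simp
    also have "\<dots> \<le> real (\<Sum>\<tau>\<in>?R. ?C)"
      unfolding of_nat_le_iff max_degree_sum_def using finR by (intro sum_mono Max_ge) auto
    finally show ?thesis by (simp add: mult.commute)
  qed

  have cob_z: "coboundary X ?i z \<tau> = g \<tau>" if \<tau>: "\<tau> \<in> ifaces X (int k)" for \<tau>
  proof -
    \<comment> \<open>\<open>e\<close> is orthogonal to cycles, and its up-Laplacian is a cycle, so
      \<open>\<parallel>\<delta> e\<parallel>^2 = \<langle>e, L e\<rangle> = 0\<close>: the
      projection preserves coboundaries on \<open>X\<close>.\<close>
    define e where "e = (\<lambda>\<sigma>. u \<sigma> + (- 1) * z \<sigma>)"
    have "cochain_inner X (int k) (coboundary X ?i e) (coboundary X ?i e)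
        = cochain_inner X ?i e (up_laplacian X ?i e)"
      using inner_coboundary_coboundary[OF finX, of ?i e e] by simp
    also have "\<dots> = 0"
      using orth[OF up_laplacian_mem_cycles[OF X]] by (simp add: cochain_inner_def e_def)
    finally have "coboundary X ?i e = (\<lambda>_. 0)"
      using inner_self_eq_0_iff[OF finX] coboundary_mem[of X ?i e] by simp
    then have "coboundary X ?i u \<tau> = coboundary X ?i z \<tau>"
      unfolding e_def coboundary_add_scaled by (simp add: fun_eq_iff)
    then show ?thesis
      using \<tau> by (simp add: coboundary_def g_def)
  qed
  have XT: "ifaces X (int k) \<subseteq> ?T"
    by (auto simp: ifaces_def k_completion_def)
  have "cochain_inner X (int k) (coboundary X ?i z) (coboundary X ?i z)
      = (\<Sum>\<tau>\<in>ifaces X (int k). (g \<tau>)\<^sup>2)"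
    by (simp add: cochain_inner_def cob_z power2_eq_square)
  also have "\<dots> = (\<Sum>\<tau>\<in>ifaces X (int k). if \<tau> \<in> ?R then 1 else 0)"
    using XT by (intro sum.cong refl g) blast
  also have "\<dots> = card (rainbow_faces X k A)"
    using finite_ifaces[OF finX] by (simp add: rainbow_faces_eq[of X k A V] sum.If_cases Int_def)
  finally have rayleigh: "spectral_gap X k * (\<Sum>\<sigma>\<in>?S. (z \<sigma>)\<^sup>2) \<le> card (rainbow_faces X k A)"
    using spectral_gap_rayleigh[OF X z] by (simp add: cochain_inner_def power2_eq_square)

  have R_pos: "0 < card ?R"
    using finR ne by (simp add: card_gt_0_iff)
  show ?thesis
  \<comment> \<open>Multiplying the Cauchy-Schwarz estimate by the gap requires it to be
    nonnegative; for a negative gap the claim is immediate, its right side being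
    nonnegative.\<close>
  proof (cases "0 \<le> spectral_gap X k")
    case True
    have "(real (card ?R))\<^sup>2 \<le> (\<Sum>\<sigma>\<in>?S. (z \<sigma>)\<^sup>2) * (\<Sum>\<sigma>\<in>?S. (f \<sigma>)\<^sup>2)"
      using Cauchy_Schwarz_ineq_sum[of z f ?S] by (simp add: zf)
    also have "\<dots> \<le> (\<Sum>\<sigma>\<in>?S. (z \<sigma>)\<^sup>2) * (?C * card ?R)"
      by (intro mult_left_mono norm_f sum_nonneg) auto
    finally have "real (card ?R) \<le> (\<Sum>\<sigma>\<in>?S. (z \<sigma>)\<^sup>2) * ?C"
      using R_pos by (simp add: power2_eq_square)
    then have "spectral_gap X k * card ?R \<le> spectral_gap X k * ((\<Sum>\<sigma>\<in>?S. (z \<sigma>)\<^sup>2) * ?C)"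
      using True by (intro mult_left_mono)
    also have "\<dots> = ?C * (spectral_gap X k * (\<Sum>\<sigma>\<in>?S. (z \<sigma>)\<^sup>2))"
      by simp
    also have "\<dots> \<le> ?C * card (rainbow_faces X k A)"
      using mult_left_mono[OF rayleigh, of ?C] by simp
    finally show ?thesis by simp
  next
    case False
    then have "spectral_gap X k * card ?R \<le> 0"
      by (simp add: mult_nonpos_nonneg)
    also have "0 \<le> real (?C * card (rainbow_faces X k A))" by simp
    finally show ?thesis by simp
  qed
qed

section \<open>Finiteness of the Cheeger constant\<close>

text \<open>Enumerate \<open>\<tau>\<close> as \<open>e 0, ..., e k\<close>. Parts
  \<open>1..k\<close> are singletons, and part 0 takes \<open>e 0\<close> together with every vertex
  outside \<open>\<tau>\<close>, so that the parts exhaust \<open>V\<close>.\<close>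

lemma rainbow_partition_exists:
  assumes "\<tau> \<subseteq> V" "card \<tau> = k + 1"
  obtains A where "nonempty_partition V k A" "\<And>i. i \<le> k \<Longrightarrow> card (\<tau> \<inter> A i) = 1"
proof -
  have "finite \<tau>" using assms(2) by (intro card_ge_0_finite) simp
  then obtain e where e: "bij_betw e {..k} \<tau>"
    using finite_same_card_bij[of "{..k}" \<tau>] assms(2) by auto
  have inj: "inj_on e {..k}" and im: "e ` {..k} = \<tau>"
    using e by (auto simp: bij_betw_def)
  define A where "A i = (if i = 0 then V - e ` {1..k} else {e i})" for i
  have eV: "e i \<in> \<tau>" "e i \<in> V" if "i \<le> k" for i
    using im assms(1) that by auto
  have e0: "e 0 \<notin> e ` {1..k}"
    using inj_onD[OF inj, of 0] by fastforce
  show ?thesis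
  proof
    show "nonempty_partition V k A"
      unfolding nonempty_partition_def
    proof (intro conjI allI impI)
      show "(\<Union>i\<le>k. A i) = V"
      proof (intro equalityI subsetI)
        fix v assume "v \<in> V"
        show "v \<in> (\<Union>i\<le>k. A i)"
        proof (cases "v \<in> e ` {1..k}")
          case True
          then obtain i where "i \<in> {1..k}" "v = e i" by blast
          then show ?thesis by (intro UN_I[of i]) (auto simp: A_def)
        next
          case False
          then show ?thesis using \<open>v \<in> V\<close> by (intro UN_I[of 0]) (auto simp: A_def)
        qed
      qed (auto simp: A_def eV split: if_splits)
      show "disjoint_family_on A {..k}"
        using inj_onD[OF inj] by (fastforce simp: disjoint_family_on_def A_def)
      show "A i \<noteq> {}" if "i \<le> k" for i
        using e0 eV(2)[of 0] by (auto simp: A_def)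
    qed
    show "card (\<tau> \<inter> A i) = 1" if "i \<le> k" for i
    proof -
      have "{..k} - {1..k} = {0}" by auto
      then have "\<tau> \<inter> (V - e ` {1..k}) = {e 0}"
        using assms(1) inj im[symmetric] inj_on_image_set_diff[OF inj, of "{..k}" "{1..k}"]
        by auto
      then have "\<tau> \<inter> A i = {e i}"
        using eV that by (auto simp: A_def)
      then show ?thesis by simp
    qed
  qed
qed

text \<open>Some \<open>k\<close>-face exists, and a partition making it rainbow has a nonzero
  denominator.\<close>

lemma cheeger_constant_finite:
  assumes "abstract_complex V X" "k_dimensional X k"
  shows "cheeger_constant V X k \<noteq> \<infinity>"
proof -
  obtain \<tau> where \<tau>: "\<tau> \<in> X" "card \<tau> = k + 1"
    using assms(2) by (auto simp: k_dimensional_def)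
  moreover have "\<tau> \<subseteq> V" and "finite V"
    using assms(1) \<tau>(1) by (auto simp: abstract_complex_def)
  ultimately obtain B where B: "nonempty_partition V k B" "\<And>i. i \<le> k \<Longrightarrow> card (\<tau> \<inter> B i) = 1"
    using rainbow_partition_exists by metis
  have "finite (rainbow_completion_faces V X k B)"
    using finite_completion[OF assms(1)] by (simp add: rainbow_completion_faces_def)
  moreover have "\<tau> \<in> rainbow_completion_faces V X k B"
    using \<tau> B(2) by (simp add: rainbow_completion_faces_def k_completion_def)
  ultimately have "cheeger_quotient V X k B \<noteq> \<infinity>"
    by (auto simp: cheeger_quotient_def)
  moreover have "cheeger_constant V X k \<le> cheeger_quotient V X k B"
    unfolding cheeger_constant_def
    using B(1) by (intro Min_le finite_cheeger_quotients \<open>finite V\<close>) auto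
  ultimately show ?thesis by auto
qed

section \<open>The eigenvalue bound for a minimising partition\<close>

theorem theorem2:
  fixes V :: "'a::linorder set" and X :: "'a set set" and k :: nat and A :: "nat \<Rightarrow> 'a set"
  assumes "k \<ge> 1"
    and "abstract_complex V X"
    and "k_dimensional X k"
    and "nonempty_partition V k A"
    and "cheeger_quotient V X k A = cheeger_constant V X k"
  shows "ereal (spectral_gap X k)
           \<le> ereal (real (max_degree_sum V X k A) / real (card V)) * cheeger_constant V X k
    \<and> (\<forall>C::real.
         (\<forall>\<sigma>\<in>ifaces X (int k - 1).
            real (card {\<tau> \<in> ifaces (k_completion V X k) (int k). \<sigma> \<subseteq> \<tau>}) \<le> C)
         \<longrightarrow> real (max_degree_sum V X k A) \<le> (real k + 1) * C
           \<and> ereal (spectral_gap X k)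
               \<le> ereal ((real k + 1) * C / real (card V)) * cheeger_constant V X k)"
proof -
  let ?R = "rainbow_completion_faces V X k A" and ?F = "rainbow_faces X k A"
    and ?M = "max_degree_sum V X k A"
  \<comment> \<open>Finiteness at the minimiser makes \<open>?R\<close> nonempty, so the
    \<open>Max\<close> in \<open>max_degree_sum\<close> is over a nonempty set and the quotient is a
    real number.\<close>
  have "cheeger_quotient V X k A \<noteq> \<infinity>"
    using cheeger_constant_finite[OF assms(2,3)] assms(5) by simp
  then have R: "card ?R > 0"
    by (auto simp: cheeger_quotient_def split: if_splits)
  then have finR: "finite ?R" and neR: "?R \<noteq> {}"
    by (auto simp: card_gt_0_iff)
  have h: "cheeger_constant V X k = ereal (real (card V) * card ?F / card ?R)"
    using R unfolding assms(5)[symmetric] by (simp add: cheeger_quotient_def)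
  have "V \<noteq> {}" "finite V"
    using assms(2,4) by (auto simp: nonempty_partition_def abstract_complex_def)
  then have V: "0 < card V" by (simp add: card_gt_0_iff)
  \<comment> \<open>Applied with \<open>D = ?M\<close> for the first inequality and
    \<open>D = (k + 1) * C\<close> for the second.\<close>
  have bound: "ereal (spectral_gap X k) \<le> ereal (D / card V) * cheeger_constant V X k"
    if "real ?M \<le> D" for D
  proof -
    have "spectral_gap X k * card ?R \<le> ?M * card ?F"
      by (rule spectral_gap_rainbow_bound[OF assms(2,4) neR])
    also have "\<dots> \<le> D * card ?F"
      using that by (simp add: mult_right_mono)
    finally show ?thesis
      using R V by (simp add: h field_simps)
  qed
  have "real ?M \<le> (real k + 1) * C"
    if C: "\<forall>\<sigma>\<in>ifaces X (int k - 1).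
      real (card {\<tau> \<in> ifaces (k_completion V X k) (int k). \<sigma> \<subseteq> \<tau>}) \<le> C" for C
  proof -
    \<comment> \<open>At a \<open>\<tau>\<close> attaining the maximum there are
      \<open>k + 1\<close> summands, each at most \<open>C\<close> because rainbow completion faces
      are among all \<open>k\<close>-faces of the completion.\<close>
    have "?M \<in> (\<lambda>\<tau>. \<Sum>v\<in>\<tau>. rainbow_degree V X k A (\<tau> - {v})) ` ?R"
      unfolding max_degree_sum_def using finR neR by (intro Max_in) auto
    then obtain \<tau> where \<tau>: "\<tau> \<in> ?R" and M: "?M = (\<Sum>v\<in>\<tau>. rainbow_degree V X k A (\<tau> - {v}))"
      by blast
    have face: "\<tau> \<in> ifaces (k_completion V X k) (int k)"
      using \<tau> by (simp add: rainbow_completion_faces_eq)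
    have "real (rainbow_degree V X k A (\<tau> - {v})) \<le> C" if "v \<in> \<tau>" for v
    proof -
      have "rainbow_degree V X k A (\<tau> - {v})
          \<le> card {\<tau>' \<in> ifaces (k_completion V X k) (int k). \<tau> - {v} \<subseteq> \<tau>'}"
        unfolding rainbow_degree_def rainbow_completion_faces_eq
        using finite_ifaces[OF finite_completion[OF assms(2)]] by (intro card_mono) auto
      then show ?thesis
        using C completion_facet_mem_ifaces[OF assms(2) face that] by fastforce
    qed
    then have "real ?M \<le> real (card \<tau>) * C"
      unfolding M of_nat_sum 
      using sum_bounded_above[of \<tau> "\<lambda>v. real (rainbow_degree V X k A (\<tau> - {v}))" C] by simp
    moreover have "card \<tau> = k + 1"
      using \<tau> by (simp add: rainbow_completion_faces_def)
    ultimately show ?thesis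
      by (simp add: algebra_simps)
  qed
  then show ?thesis
    using bound by blast
qed

end
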